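(* Let $n \geq 2$, let $(\ell_d)_{d \in D_n}$ be integers with $\ell_d \geq 2$ for all $d\in D_n$, let $(\lambda_I)_{I \subset [n]}$ be the associated numbers, and let $G \subset \mathbb{R}^n$ be the set constructed in the context. Then: (i) $|G| = \lambda_{[n]}$. (ii) For every $d \in D_n$, $G$ has no strictly monotonic sequence of length $\ell_d + 1$ in direction $d$.
   Context: Notation: $[n] = \{1,\ldots,n\}$; for $A \subset \mathbb{R}^n$ and $s \in \mathbb{R}^n$, $A + s = \{x+s : x \in A\}$; $\|z\|_\infty = \max_i |z_i|$; $w(A) = \max_{x,y \in A} \|x-y\|_\infty$. A sequence of points $(x^j)_{j=1}^{\ell}$ in $\mathbb{R}^n$ is strictly monotonic in direction $d \in \{-1,0,1\}^n$ if for each $i \in [n]$ the sequence $(x^j_i)_{j=1}^{\ell}$ is strictly decreasing, constant, or strictly increasing according to whether $d_i = -1$, $0$ or $1$. A set contains (has) a strictly monotonic sequence of length $\ell$ in direction $d$ if it contains distinct points $x^1,\ldots,x^\ell$ such that $(x^j)_{j=1}^\ell$ is strictly monotonic in direction $d$. $D_n = \{ d \in \{-1,0,1\}^n : d \neq (0,\ldots,0),\ d_{i} = 1 \text{ for } i = \min\{i' : d_{i'} \neq 0\}\}$ and $C_n = \{c \in \{-1,1\}^n : c_1 = 1\} = \{c^1,\ldots,c^{2^{n-1}}\}$ (a fixed enumeration). For $d \in \{-1,0,1\}^n$ let $N(d) = \{i : d_i \neq 0\}$. For nonempty $I \subset [n]$ put $m_I = \prod_{d \in D_n : N(d) = I}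 \ell_d$; define $\lambda_\emptyset = 1$ and $\lambda_I = m_I \cdot \max_{i \in I}\lambda_{I \setminus \{i\}}$ for $I \neq \emptyset$. Construction of $G$. Choose $i_0 \in [n]$ with $\lambda_{[n]} = m_{[n]} \lambda_{[n]\setminus\{i_0\}}$. For $d \in D_{n-1}$ let $\ell'_d = \ell_{(d_1,\ldots,d_{i_0-1},0,d_{i_0},\ldots,d_{n-1})}$. Let $F \subset \mathbb{R}^{n-1}$ be a set of size $|F| = \lambda_{[n]\setminus\{i_0\}}$ which, for every $d \in D_{n-1}$, contains no strictly monotonic sequence of length $\ell'_d+1$ in direction $d$ (such an $F$ is obtained by induction on $n$, starting in dimension $1$ with $\ell_d$ distinct points of $\mathbb{R}$ for the unique $d \in D_1$). Let $$F' = \left\{ \tfrac{1}{w(F)+1}(x_1,\ldots,x_{i_0-1},0,x_{i_0},\ldots,x_{n-1}) : (x_1,\ldots,x_{n-1}) \in F \right\} \subset \mathbb{R}^n.$$ Let $\ell''_i = \ell_{c^i}$ for $1 \leq i \leq 2^{n-1}$, let $L_k = \prod_{i=1}^k \ell''_i$ (with $L_0 = 1$), and define recursively $A_0 = \{0\} \subset \mathbb{R}^n$ and $A_k = \bigcup_{m=0}^{\ell''_k - 1} (A_{k-1} + m L_{k-1} c^k)$ for $1 \leq k \leq 2^{n-1}$. Put $E = A_{2^{n-1}}$. Finally, $$G = \bigcup_{x \in E} (F' + x).$$ *)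

theory Defs
  imports "Jordan_Normal_Form.Matrix"
begin

text \<open>
  The dimension varies (the construction passes from dimension \<open>n - 1\<close> to \<open>n\<close>), so points of
  \<open>n\<close>-dimensional real space are the members of \<^term>\<open>carrier_vec n :: real vec set\<close>. Coordinates
  are numbered \<open>0, \<dots>, n - 1\<close> instead of \<open>1, \<dots>, n\<close>; the index set \<open>[n]\<close> becomes \<^term>\<open>{..<n::nat}\<close>.
\<close>

subsection \<open>Directions and monotonic sequences\<close>

definition supp :: "int vec \<Rightarrow> nat set" where
  "supp d = {i. i < dim_vec d \<and> d $ i \<noteq> 0}"

definition directions :: "nat \<Rightarrow> int vec set" where
  "directions n = {d \<in> carrier_vec n.
     (\<forall>i<n. d $ i \<in> {-1, 0, 1}) \<and> d \<noteq> 0\<^sub>v n \<and> d $ Min (supp d) = 1}"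

definition full_directions :: "nat \<Rightarrow> int vec set" where
  "full_directions n = {c \<in> carrier_vec n. (\<forall>i<n. c $ i \<in> {-1, 1}) \<and> c $ 0 = 1}"

definition strictly_monotonic_seq ::
  "nat \<Rightarrow> nat \<Rightarrow> (nat \<Rightarrow> real vec) \<Rightarrow> int vec \<Rightarrow> bool" where
  "strictly_monotonic_seq n len x d \<longleftrightarrow> (\<forall>i<n.
     (d $ i = -1 \<longrightarrow> strict_antimono_on {1..len} (\<lambda>j. x j $ i)) \<and>
     (d $ i = 0 \<longrightarrow> (\<forall>j\<in>{1..len}. \<forall>k\<in>{1..len}. x j $ i = x k $ i)) \<and>
     (d $ i = 1 \<longrightarrow> strict_mono_on {1..len} (\<lambda>j. x j $ i)))"

definition has_strictly_monotonic_seq ::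
  "nat \<Rightarrow> real vec set \<Rightarrow> nat \<Rightarrow> int vec \<Rightarrow> bool" where
  "has_strictly_monotonic_seq n A len d \<longleftrightarrow>
     (\<exists>x. x ` {1..len} \<subseteq> A \<and> inj_on x {1..len} \<and> strictly_monotonic_seq n len x d)"

subsection \<open>The numbers \<open>m\<^sub>I\<close> and \<open>\<lambda>\<^sub>I\<close>\<close>

definition m_num :: "nat \<Rightarrow> (int vec \<Rightarrow> nat) \<Rightarrow> nat set \<Rightarrow> nat" where
  "m_num n l I = (\<Prod>d\<in>{d \<in> directions n. supp d = I}. l d)"

text \<open>Only finite \<open>I\<close> matter; the value 1 on infinite sets just makes the recursion total.\<close>

function lam_num :: "nat \<Rightarrow> (int vec \<Rightarrow> nat) \<Rightarrow> nat set \<Rightarrow> nat" where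
  "lam_num n l I = (if finite I \<and> I \<noteq> {}
     then m_num n l I * Max ((\<lambda>i. lam_num n l (I - {i})) ` I) else 1)"
  by auto
termination
  by (relation "measure (\<lambda>(n, l, I). card I)") (auto simp: card_gt_0_iff)

declare lam_num.simps [simp del]

lemma lam_num_empty: "lam_num n l {} = 1"
  by (simp add: lam_num.simps)

lemma lam_num_nonempty:
  "finite I \<Longrightarrow> I \<noteq> {} \<Longrightarrow> lam_num n l I = m_num n l I * Max ((\<lambda>i. lam_num n l (I - {i})) ` I)"
  by (subst lam_num.simps) simp

subsection \<open>The construction\<close>

definition translate :: "real vec set \<Rightarrow> real vec \<Rightarrow> real vec set" where
  "translate A s = (\<lambda>x. x + s) ` A"

definition sup_norm :: "real vec \<Rightarrow> real" where
  "sup_norm z = Max ((\<lambda>i. \<bar>z $ i\<bar>) ` {..<dim_vec z})"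

definition width :: "real vec set \<Rightarrow> real" where
  "width A = Max ((\<lambda>(x, y). sup_norm (x - y)) ` (A \<times> A))"

definition insert_zero :: "nat \<Rightarrow> 'a::zero vec \<Rightarrow> 'a vec" where
  "insert_zero i v = vec (Suc (dim_vec v))
     (\<lambda>j. if j < i then v $ j else if j = i then 0 else v $ (j - 1))"

definition restricted_lengths :: "(int vec \<Rightarrow> nat) \<Rightarrow> nat \<Rightarrow> int vec \<Rightarrow> nat" where
  "restricted_lengths l i0 d = l (insert_zero i0 d)"

definition scaled_copy :: "nat \<Rightarrow> real vec set \<Rightarrow> real vec set" where
  "scaled_copy i0 F = (\<lambda>x. (1 / (width F + 1)) \<cdot>\<^sub>v insert_zero i0 x) ` F"

text \<open>Below, \<open>c 1, \<dots>, c (2 ^ (n - 1))\<close> is an enumeration of \<^term>\<open>full_directions n\<close>.\<close>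

definition L_num :: "(int vec \<Rightarrow> nat) \<Rightarrow> (nat \<Rightarrow> int vec) \<Rightarrow> nat \<Rightarrow> nat" where
  "L_num l c k = (\<Prod>i=1..k. l (c i))"

fun A_set :: "nat \<Rightarrow> (int vec \<Rightarrow> nat) \<Rightarrow> (nat \<Rightarrow> int vec) \<Rightarrow> nat \<Rightarrow> real vec set" where
  "A_set n l c 0 = {0\<^sub>v n}"
| "A_set n l c (Suc k) = (\<Union>m<l (c (Suc k)).
     translate (A_set n l c k) (real (m * L_num l c k) \<cdot>\<^sub>v map_vec real_of_int (c (Suc k))))"

definition E_set :: "nat \<Rightarrow> (int vec \<Rightarrow> nat) \<Rightarrow> (nat \<Rightarrow> int vec) \<Rightarrow> real vec set" where
  "E_set n l c = A_set n l c (2 ^ (n - 1))"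

definition G_set ::
  "nat \<Rightarrow> (int vec \<Rightarrow> nat) \<Rightarrow> nat \<Rightarrow> real vec set \<Rightarrow> (nat \<Rightarrow> int vec) \<Rightarrow> real vec set" where
  "G_set n l i0 F c = (\<Union>x\<in>E_set n l c. translate (scaled_copy i0 F) x)"

end

theory Submission
  imports Defs
begin

text \<open>
  The set \<open>G\<close> lives on two scales. The coarse part \<open>E\<close> consists of the integer points
  \<open>\<Sum>\<^sub>j a\<^sub>j L\<^bsub>j-1\<^esub> c\<^sup>j\<close> with digits \<open>a\<^sub>j < \<ell>\<^bsub>c\<^sup>j\<^esub>\<close>. Every coordinate of such a point is a
  mixed-radix expansion in base \<open>(\<ell>\<^bsub>c\<^sup>j\<^esub>)\<^sub>j\<close> with signs \<open>c\<^sup>j\<^sub>i = \<plusminus>1\<close> attached to the digits. Signs do not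
  spoil the usual dominance of the leading digit: if \<open>t\<close> is the largest index at which the digits of
  two points differ, the difference of the points has the sign pattern \<open>\<plusminus>c\<^sup>t\<close>, the outer sign being
  that of the difference of the \<open>t\<close>-th digits, and every coordinate of it has absolute value at
  least 1 (\<open>grid_point_separation\<close>). The fine part, the scaled copy of \<open>F\<close>, has all coordinate
  differences strictly below 1 (\<open>embed_close\<close>), and so cannot change these signs
  (\<open>sgn_diff_points\<close>).

  Hence the decomposition of a point of \<open>G\<close> into a coarse and a fine part is unique, and
  \<open>card G\<close> is the product of the number of digit sequences, which is \<open>m\<^bsub>[n]\<^esub>\<close>, and \<open>card F\<close>.

  Now take a sequence in \<open>G\<close> that is strictly monotonic in direction \<open>d\<close>. If \<open>d = c\<^sup>k\<close> has full
  support, then any two terms have different coarse parts, because they differ in coordinate \<open>i\<^sub>0\<close>,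
  which is constant on the fine part. The sign pattern of their difference is \<open>c\<^sup>k\<close>, so the leading
  differing digit is the \<open>k\<close>-th one and it increases along the sequence; there are only \<open>\<ell>\<^sub>d\<close> values
  for it. If instead \<open>d\<^sub>i = 0\<close> for some \<open>i\<close>, then the coarse part must be constant along the
  sequence, since different coarse parts disagree in every coordinate. All the movement happens
  in the fine part, so \<open>d\<^bsub>i\<^sub>0\<^esub> = 0\<close>, and removing coordinate \<open>i\<^sub>0\<close> yields a sequence of the same length
  in \<open>F\<close>, to which the hypothesis on \<open>F\<close> applies.
\<close>

section \<open>Monotonic sequences as sign patterns\<close>

text \<open>
  Signs of differences are what survives a positive rescaling and a small perturbation, so all the
  later arguments about monotonic sequences go through this form.
\<close>

lemma strictly_monotonic_seq_iff_sgn: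
  assumes "\<forall>i<n. d $ i \<in> {-1, 0, 1}"
  shows "strictly_monotonic_seq n len x d \<longleftrightarrow>
    (\<forall>p\<in>{1..len}. \<forall>q\<in>{1..len}. p < q \<longrightarrow>
       (\<forall>i<n. sgn (x q $ i - x p $ i) = real_of_int (d $ i)))"
    (is "_ = ?sgns")
proof
  assume mono: "strictly_monotonic_seq n len x d"
  show ?sgns
  proof (intro ballI impI allI)
    fix p q i assume pq: "p \<in> {1..len}" "q \<in> {1..len}" "p < q" and i: "i < n"
    consider "d $ i = -1" | "d $ i = 0" | "d $ i = 1"
      using assms i by blast
    then show "sgn (x q $ i - x p $ i) = real_of_int (d $ i)"
    proof cases
      case 1
      then have "strict_antimono_on {1..len} (\<lambda>j. x j $ i)"
        using mono i unfolding strictly_monotonic_seq_def by blast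
      then have "x q $ i < x p $ i"
        using pq by (auto simp: monotone_on_def)
      with 1 show ?thesis by simp
    next
      case 2
      then have "x q $ i = x p $ i"
        using mono i pq unfolding strictly_monotonic_seq_def by blast
      with 2 show ?thesis by simp
    next
      case 3
      then have "strict_mono_on {1..len} (\<lambda>j. x j $ i)"
        using mono i unfolding strictly_monotonic_seq_def by blast
      then have "x p $ i < x q $ i"
        using pq by (auto simp: monotone_on_def)
      with 3 show ?thesis by simp
    qed
  qed
next
  assume sgns: ?sgns
  show "strictly_monotonic_seq n len x d"
    unfolding strictly_monotonic_seq_def
  proof (intro allI impI conjI)
    fix i assume i: "i < n"
    show "strict_antimono_on {1..len} (\<lambda>j. x j $ i)" if "d $ i = -1"
    proof (rule monotone_onI)
      fix p q assume "p \<in> {1..len}" "q \<in> {1..len}" "p < q"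
      then have "sgn (x q $ i - x p $ i) = -1" using sgns i that by auto
      then show "x p $ i > x q $ i" by (simp add: sgn_if split: if_splits)
    qed
    show "strict_mono_on {1..len} (\<lambda>j. x j $ i)" if "d $ i = 1"
    proof (rule monotone_onI)
      fix p q assume "p \<in> {1..len}" "q \<in> {1..len}" "p < q"
      then have "sgn (x q $ i - x p $ i) = 1" using sgns i that by auto
      then show "x p $ i < x q $ i" by (simp add: sgn_if split: if_splits)
    qed
    show "\<forall>p\<in>{1..len}. \<forall>q\<in>{1..len}. x p $ i = x q $ i" if "d $ i = 0"
    proof (intro ballI)
      fix p q assume pq: "p \<in> {1..len}" "q \<in> {1..len}"
      have eq: "x p' $ i = x q' $ i" if "p' \<in> {1..len}" "q' \<in> {1..len}" "p' < q'" for p' q'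
      proof -
        have "sgn (x q' $ i - x p' $ i) = 0" using sgns i that \<open>d $ i = 0\<close> by auto
        then show ?thesis by (simp add: sgn_zero_iff)
      qed
      show "x p $ i = x q $ i"
        using eq[OF pq] eq[OF pq(2,1)] by (metis linorder_neqE_nat)
    qed
  qed
qed

section \<open>Directions\<close>

lemma supp_full_iff:
  "d \<in> carrier_vec n \<Longrightarrow> supp d = {..<n} \<longleftrightarrow> (\<forall>i<n. d $ i \<noteq> 0)"
  by (auto simp: supp_def)

text \<open>
  If the support is everything, its minimum is 0, and the normalisation of the first nonzero entry
  becomes the condition \<open>c $ 0 = 1\<close>.
\<close>

lemma full_support_directions:
  assumes "n > 0"
  shows "{d \<in> directions n. supp d = {..<n}} = full_directions n"
proof -
  have min0: "Min {..<n} = 0"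
    using assms by (intro Min_eqI) auto
  have "d \<in> directions n \<and> supp d = {..<n} \<longleftrightarrow> d \<in> full_directions n" (is "?l \<longleftrightarrow> ?r") for d
  proof
    assume ?l
    then have dir: "d \<in> directions n" and supp: "supp d = {..<n}" by blast+
    from dir have carrier: "d \<in> carrier_vec n" and val: "\<And>i. i < n \<Longrightarrow> d $ i \<in> {-1, 0, 1}"
      and lead: "d $ Min (supp d) = 1"
      unfolding directions_def by blast+
    have "\<forall>i<n. d $ i \<noteq> 0" using supp supp_full_iff[OF carrier] by blast
    moreover have "d $ 0 = 1" using lead supp min0 by simp
    ultimately show ?r using carrier val unfolding full_directions_def by blast
  next
    assume d: ?r
    then have carrier: "d \<in> carrier_vec n" and val: "\<And>i. i < n \<Longrightarrow> d $ i \<in> {-1, 1}"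
      and lead: "d $ 0 = 1"
      unfolding full_directions_def by blast+
    have supp: "supp d = {..<n}"
      unfolding supp_full_iff[OF carrier]
    proof (intro allI impI)
      fix i assume "i < n"
      from val[OF this] show "d $ i \<noteq> 0" by auto
    qed
    moreover have "d \<noteq> 0\<^sub>v n"
      using lead assms by auto
    ultimately show ?l
      using carrier val lead min0 unfolding directions_def by auto
  qed
  then show ?thesis by blast
qed

text \<open>
  The increasing enumeration of the indices other than \<open>i\<close>, that is, the new position of
  coordinate \<open>j\<close> after a zero has been inserted at position \<open>i\<close>.
\<close>

definition skip :: "nat \<Rightarrow> nat \<Rightarrow> nat" where
  "skip i j = (if j < i then j else Suc j)"

lemma strict_mono_skip: "strict_mono (skip i)"
  by (auto simp: strict_mono_def skip_def)

lemma skip_less: "j < n - 1 \<Longrightarrow> skip i j < n"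
  by (auto simp: skip_def)

lemma insert_zero_skip: "j < dim_vec v \<Longrightarrow> insert_zero i v $ skip i j = v $ j"
  by (auto simp: insert_zero_def skip_def)

lemma insert_zero_at: "i \<le> dim_vec v \<Longrightarrow> insert_zero i v $ i = 0"
  by (auto simp: insert_zero_def)

lemma dim_insert_zero [simp]: "dim_vec (insert_zero i v) = Suc (dim_vec v)"
  by (simp add: insert_zero_def)

lemma skip_cases:
  assumes "j < n" "i < n"
  obtains "j = i" | j' where "j' < n - 1" "j = skip i j'"
proof (cases j i rule: linorder_cases)
  case less
  then show ?thesis using that(2)[of j] assms by (simp add: skip_def)
next
  case greater
  then show ?thesis using that(2)[of "j - 1"] assms by (simp add: skip_def)
qed (use that in auto)

text \<open>
  Deleting a zero entry keeps the order of the remaining entries, so the first nonzero entry is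
  still 1.
\<close>

lemma directions_with_zero:
  assumes d: "d \<in> directions n" and i: "i < n" and zero: "d $ i = 0"
  obtains d' where "d' \<in> directions (n - 1)" "d = insert_zero i d'"
proof -
  define d' where "d' = vec (n - 1) (\<lambda>j. d $ skip i j)"
  have dim: "dim_vec d = n" using d by (auto simp: directions_def)
  have dim': "dim_vec d' = n - 1" by (simp add: d'_def)
  have eq: "d = insert_zero i d'"
  proof (rule eq_vecI)
    fix j assume "j < dim_vec (insert_zero i d')"
    then have "j < n" using i by (simp add: d'_def)
    from skip_cases[OF this i] show "d $ j = insert_zero i d' $ j"
    proof cases
      case 1
      then show ?thesis using zero i by (simp add: insert_zero_at dim')
    next
      case (2 j')
      then show ?thesis using insert_zero_skip[of j' d' i] by (simp add: d'_def)
    qed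
  qed (use i dim in \<open>simp add: d'_def\<close>)
  have supp_eq: "supp d = skip i ` supp d'"
  proof
    show "supp d \<subseteq> skip i ` supp d'"
    proof
      fix j assume "j \<in> supp d"
      then have j: "j < n" "d $ j \<noteq> 0" by (auto simp: supp_def dim)
      then show "j \<in> skip i ` supp d'"
        using zero by (cases rule: skip_cases[OF j(1) i]) (auto simp: supp_def d'_def)
    qed
    show "skip i ` supp d' \<subseteq> supp d"
      by (auto simp: supp_def d'_def dim skip_less)
  qed
  have "d \<noteq> 0\<^sub>v n" using d by (auto simp: directions_def)
  then have "supp d \<noteq> {}" using dim by (auto simp: supp_def)
  then have nonempty: "supp d' \<noteq> {}" using supp_eq by auto
  have fin: "finite (supp d')" by (simp add: supp_def)
  have "Min (supp d) = skip i (Min (supp d'))"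
    using mono_Min_commute[OF strict_mono_mono[OF strict_mono_skip] fin nonempty] supp_eq by simp
  moreover have "Min (supp d') < n - 1"
    using Min_in[OF fin nonempty] by (auto simp: supp_def d'_def)
  ultimately have "d' $ Min (supp d') = 1"
    using d by (simp add: d'_def directions_def)
  moreover have "d' \<noteq> 0\<^sub>v (n - 1)"
    using nonempty by (auto simp: supp_def)
  moreover have "d' $ j \<in> {-1, 0, 1}" if "j < n - 1" for j
    using d that skip_less[OF that] by (auto simp: directions_def d'_def)
  moreover have "d' \<in> carrier_vec (n - 1)" by (simp add: d'_def)
  ultimately have "d' \<in> directions (n - 1)"
    by (auto simp: directions_def)
  then show ?thesis using eq by (rule that)
qed

section \<open>Signed mixed-radix expansions\<close>

text \<open>
  The largest mixed-radix number with \<open>k\<close> digits is one less than the next place value; allowing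
  digits of either sign does not change this, by the triangle inequality.
\<close>

lemma mixed_radix_bound:
  fixes \<delta> :: "nat \<Rightarrow> int" and r :: "nat \<Rightarrow> nat"
  assumes "\<And>j. j \<in> {1..k} \<Longrightarrow> \<bar>\<delta> j\<bar> < int (r j)"
  shows "\<bar>\<Sum>j=1..k. \<delta> j * int (\<Prod>i=1..j-1. r i)\<bar> < int (\<Prod>i=1..k. r i)"
  using assms
proof (induction k)
  case 0
  then show ?case by simp
next
  case (Suc k)
  let ?S = "\<Sum>j=1..k. \<delta> j * int (\<Prod>i=1..j-1. r i)" and ?P = "int (\<Prod>i=1..k. r i)"
  have IH: "\<bar>?S\<bar> < ?P" using Suc by simp
  have "\<bar>?S + \<delta> (Suc k) * ?P\<bar> \<le> \<bar>?S\<bar> + \<bar>\<delta> (Suc k)\<bar> * ?P"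
    using abs_triangle_ineq[of ?S "\<delta> (Suc k) * ?P"] by (simp only: abs_mult abs_of_nat)
  also have "\<dots> < (1 + \<bar>\<delta> (Suc k)\<bar>) * ?P"
    using IH by (simp add: algebra_simps)
  also have "\<dots> \<le> int (r (Suc k)) * ?P"
    using Suc.prems[of "Suc k"] by (intro mult_right_mono of_nat_0_le_iff) simp
  finally show ?case by (simp add: mult.commute)
qed

text \<open>
  The leading digit contributes at least its place value in absolute value, which by the bound
  above exceeds everything that the lower digits can contribute.
\<close>

lemma mixed_radix_leading_digit:
  fixes \<delta> :: "nat \<Rightarrow> int" and r :: "nat \<Rightarrow> nat"
  assumes bound: "\<And>j. j \<in> {1..k} \<Longrightarrow> \<bar>\<delta> j\<bar> < int (r j)"
    and t: "t \<in> {1..k}" "\<delta> t \<noteq> 0" and above: "\<And>j. t < j \<Longrightarrow> j \<le> k \<Longrightarrow> \<delta> j = 0"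
  shows "sgn (\<delta> t) * (\<Sum>j=1..k. \<delta> j * int (\<Prod>i=1..j-1. r i)) > 0"
proof -
  let ?f = "\<lambda>j. \<delta> j * int (\<Prod>i=1..j-1. r i)"
  let ?S = "\<Sum>j=1..t-1. ?f j" and ?P = "int (\<Prod>i=1..t-1. r i)"
  have "(\<Sum>j=1..k. ?f j) = (\<Sum>j=1..t. ?f j)"
    using t above by (intro sum.mono_neutral_right) auto
  also have "\<dots> = ?S + \<delta> t * ?P"
    using t by (cases t) (simp_all del: of_nat_prod)
  finally have sum: "(\<Sum>j=1..k. ?f j) = ?S + \<delta> t * ?P" .
  have S: "\<bar>?S\<bar> < ?P"
    using t by (intro mixed_radix_bound bound) auto
  have "sgn (\<delta> t) * (?S + \<delta> t * ?P) = sgn (\<delta> t) * ?S + \<bar>\<delta> t\<bar> * ?P"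
    by (simp only: distrib_left abs_sgn mult_ac)
  moreover have "\<bar>\<delta> t\<bar> * ?P \<ge> 1 * ?P"
    using t by (intro mult_right_mono of_nat_0_le_iff) simp
  moreover have "\<bar>sgn (\<delta> t) * ?S\<bar> \<le> \<bar>?S\<bar>"
    using t by (simp only: abs_mult abs_sgn_eq) simp
  ultimately show ?thesis unfolding sum using S by linarith
qed

text \<open>
  The point of the coarse grid with digit sequence \<open>a\<close>. The sum is formed in the integers, so that
  a positive coordinate difference is automatically at least 1.
\<close>

definition grid_point ::
  "nat \<Rightarrow> (int vec \<Rightarrow> nat) \<Rightarrow> (nat \<Rightarrow> int vec) \<Rightarrow> nat \<Rightarrow> (nat \<Rightarrow> nat) \<Rightarrow> real vec" where
  "grid_point n l c k a =
     vec n (\<lambda>i. real_of_int (\<Sum>j=1..k. int (a j) * int (L_num l c (j - 1)) * c j $ i))"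

lemma dim_grid_point [simp]: "dim_vec (grid_point n l c k a) = n"
  by (simp add: grid_point_def)

abbreviation digits :: "(int vec \<Rightarrow> nat) \<Rightarrow> (nat \<Rightarrow> int vec) \<Rightarrow> nat \<Rightarrow> (nat \<Rightarrow> nat) set" where
  "digits l c k \<equiv> (\<Pi>\<^sub>E j\<in>{1..k}. {..<l (c j)})"

lemma A_set_eq_grid_points:
  assumes "\<And>j. j \<in> {1..k} \<Longrightarrow> c j \<in> carrier_vec n"
  shows "A_set n l c k = grid_point n l c k ` digits l c k"
  using assms
proof (induction k)
  case 0
  then show ?case by (auto simp: grid_point_def intro!: eq_vecI)
next
  case (Suc k)
  have IH: "A_set n l c k = grid_point n l c k ` digits l c k"
    using Suc by simp
  have step: "grid_point n l c k a + real (a' (Suc k) * L_num l c k) \<cdot>\<^sub>v map_vec real_of_int (c (Suc k))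
      = grid_point n l c (Suc k) a'" if "\<And>j. j \<in> {1..k} \<Longrightarrow> a j = a' j" for a a'
    using that Suc.prems[of "Suc k"] by (intro eq_vecI) (auto simp: grid_point_def)
  show ?case
  proof
    show "A_set n l c (Suc k) \<subseteq> grid_point n l c (Suc k) ` digits l c (Suc k)"
    proof
      fix x assume "x \<in> A_set n l c (Suc k)"
      then obtain m a where m: "m < l (c (Suc k))" and a: "a \<in> digits l c k"
        and x: "x = grid_point n l c k a
                  + real (m * L_num l c k) \<cdot>\<^sub>v map_vec real_of_int (c (Suc k))"
        by (auto simp: translate_def IH)
      let ?a = "a(Suc k := m)"
      have "x = grid_point n l c (Suc k) ?a"
        using step[of a ?a] x by simp
      moreover have "?a \<in> digits l c (Suc k)"
        using m a by (auto simp: PiE_iff extensional_def le_Suc_eq)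
      ultimately show "x \<in> grid_point n l c (Suc k) ` digits l c (Suc k)" by blast
    qed
    show "grid_point n l c (Suc k) ` digits l c (Suc k) \<subseteq> A_set n l c (Suc k)"
    proof
      fix x assume "x \<in> grid_point n l c (Suc k) ` digits l c (Suc k)"
      then obtain a where a: "a \<in> digits l c (Suc k)" and x: "x = grid_point n l c (Suc k) a" by blast
      let ?a = "restrict a {1..k}"
      have "?a \<in> digits l c k" "a (Suc k) < l (c (Suc k))"
        using a by (auto simp: PiE_iff)
      moreover have "x = grid_point n l c k ?a
          + real (a (Suc k) * L_num l c k) \<cdot>\<^sub>v map_vec real_of_int (c (Suc k))"
        using step[of ?a a] x by simp
      ultimately show "x \<in> A_set n l c (Suc k)"
        unfolding A_set.simps IH translate_def by blast
    qed
  qed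
qed

text \<open>
  In each coordinate the difference is a mixed-radix expansion whose digits \<open>b j - a j\<close> carry the
  signs of \<open>c j\<close>. The position \<open>t\<close> of the leading nonzero digit is the same for all coordinates,
  which is why the difference follows the sign pattern of the single vector \<open>c t\<close>.
\<close>

lemma grid_point_separation:
  assumes c: "\<And>j. j \<in> {1..k} \<Longrightarrow> c j \<in> full_directions n"
    and a: "a \<in> digits l c k" and b: "b \<in> digits l c k" and neq: "a \<noteq> b"
  obtains t where "t \<in> {1..k}" "a t \<noteq> b t"
    "\<And>i. i < n \<Longrightarrow> real_of_int (sgn (int (b t) - int (a t)) * c t $ i)
                  * (grid_point n l c k b $ i - grid_point n l c k a $ i) \<ge> 1"
proof -
  define T where "T = {j \<in> {1..k}. a j \<noteq> b j}"
  define t where "t = Max T"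
  have "T \<noteq> {}"
    using neq PiE_ext[OF a b] by (auto simp: T_def)
  then have tT: "t \<in> T" unfolding t_def by (intro Max_in) (auto simp: T_def)
  have above: "a j = b j" if "t < j" "j \<le> k" for j
  proof (rule ccontr)
    assume "a j \<noteq> b j"
    then have "j \<in> T" using that by (auto simp: T_def)
    then have "j \<le> t" unfolding t_def by (intro Max_ge) (auto simp: T_def)
    with that show False by simp
  qed
  have "real_of_int (sgn (int (b t) - int (a t)) * c t $ i)
      * (grid_point n l c k b $ i - grid_point n l c k a $ i) \<ge> 1" if i: "i < n" for i
  proof -
    define \<delta> where "\<delta> j = (int (b j) - int (a j)) * c j $ i" for j
    have unit: "\<bar>c j $ i\<bar> = 1" if "j \<in> {1..k}" for j
      using c[OF that] i by (auto simp: full_directions_def)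
    have "\<bar>\<delta> j\<bar> < int (l (c j))" if j: "j \<in> {1..k}" for j
    proof -
      have "a j < l (c j)" "b j < l (c j)" using a b j by auto
      then show ?thesis by (simp add: \<delta>_def abs_mult unit[OF j])
    qed
    moreover have t: "t \<in> {1..k}" using tT by (simp add: T_def)
    moreover have "\<delta> t \<noteq> 0"
      using tT unit[OF t] by (auto simp: \<delta>_def T_def)
    moreover have "\<delta> j = 0" if "t < j" "j \<le> k" for j
      using above[OF that] by (simp add: \<delta>_def)
    ultimately have "sgn (\<delta> t) * (\<Sum>j=1..k. \<delta> j * int (\<Prod>i=1..j-1. l (c i))) > 0"
      by (rule mixed_radix_leading_digit)
    moreover have "sgn (\<delta> t) = sgn (int (b t) - int (a t)) * c t $ i"
    proof -
      have "c t $ i = 1 \<or> c t $ i = -1" using unit[OF t] by auto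
      then show ?thesis by (auto simp: \<delta>_def sgn_mult)
    qed
    moreover have "grid_point n l c k b $ i - grid_point n l c k a $ i =
        real_of_int (\<Sum>j=1..k. \<delta> j * int (\<Prod>i=1..j-1. l (c i)))"
      using i by (simp add: grid_point_def L_num_def \<delta>_def algebra_simps flip: sum_subtractf)
    ultimately show ?thesis
      by (simp only: flip: of_int_mult)
  qed
  then show ?thesis using that[of t] tT by (auto simp: T_def)
qed

section \<open>The scaled copy of the lower-dimensional set\<close>

lemma abs_index_le_sup_norm: "i < dim_vec z \<Longrightarrow> \<bar>z $ i\<bar> \<le> sup_norm z"
  unfolding sup_norm_def by (intro Max_ge) auto

lemma abs_diff_le_width:
  assumes "finite F" "F \<subseteq> carrier_vec m" "x \<in> F" "y \<in> F" "i < m"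
  shows "\<bar>x $ i - y $ i\<bar> \<le> width F"
proof -
  have "x \<in> carrier_vec m" "y \<in> carrier_vec m" using assms by auto
  then have "\<bar>x $ i - y $ i\<bar> \<le> sup_norm (x - y)"
    using abs_index_le_sup_norm[of i "x - y"] assms by simp
  also have "\<dots> \<le> width F"
    unfolding width_def using assms by (intro Max_ge) auto
  finally show ?thesis .
qed

lemma width_nonneg:
  assumes "finite F" "F \<noteq> {}" "F \<subseteq> carrier_vec m" "m > 0"
  shows "width F \<ge> 0"
proof -
  obtain x where "x \<in> F" using assms by blast
  then show ?thesis using abs_diff_le_width[OF assms(1,3), of x x 0] assms by simp
qed

locale scaled_set =
  fixes n i0 :: nat and F :: "real vec set"
  assumes n: "n \<ge> 2" and i0: "i0 < n"
    and F: "finite F" "F \<noteq> {}" "F \<subseteq> carrier_vec (n - 1)"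
begin

definition embed :: "real vec \<Rightarrow> real vec" where
  "embed x = (1 / (width F + 1)) \<cdot>\<^sub>v insert_zero i0 x"

lemma scaled_copy_eq: "scaled_copy i0 F = embed ` F"
  by (simp add: scaled_copy_def embed_def)

lemma width_F_nonneg: "width F \<ge> 0"
  using width_nonneg[OF F] n by simp

lemma dim_embed: "x \<in> F \<Longrightarrow> dim_vec (embed x) = n"
  using F n by (auto simp: embed_def)

lemma embed_skip:
  assumes "x \<in> F" "j < n - 1"
  shows "embed x $ skip i0 j = x $ j / (width F + 1)"
proof -
  have "dim_vec x = n - 1" using assms F by auto
  then show ?thesis
    using assms insert_zero_skip[of j x i0] skip_less[OF assms(2)] n by (simp add: embed_def)
qed

lemma embed_at: "x \<in> F \<Longrightarrow> embed x $ i0 = 0"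
  using F n i0 insert_zero_at[of i0 x] by (auto simp: embed_def subset_iff)

text \<open>
  The denominator \<open>width F + 1\<close> brings the differences strictly below 1, the lower
  bound for the coordinate differences of distinct coarse points.
\<close>

lemma embed_close:
  assumes "x \<in> F" "y \<in> F" "i < n"
  shows "\<bar>embed x $ i - embed y $ i\<bar> < 1"
  using skip_cases[OF assms(3) i0]
proof cases
  case 1
  then show ?thesis using assms by (simp add: embed_at)
next
  case (2 j)
  have "\<bar>x $ j - y $ j\<bar> \<le> width F"
    using abs_diff_le_width[OF F(1,3)] assms 2 by blast
  moreover have "embed x $ i - embed y $ i = (x $ j - y $ j) / (width F + 1)"
    using assms 2 by (simp add: embed_skip diff_divide_distrib)
  ultimately show ?thesis using width_F_nonneg by (simp add: abs_divide)
qed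

lemma inj_embed: "inj_on embed F"
proof
  fix x y assume xy: "x \<in> F" "y \<in> F" "embed x = embed y"
  have dims: "dim_vec x = n - 1" "dim_vec y = n - 1" using xy F by auto
  show "x = y"
  proof (rule eq_vecI)
    fix j assume "j < dim_vec y"
    then have "j < n - 1" using dims by simp
    then show "x $ j = y $ j"
      using embed_skip[of x j] embed_skip[of y j] xy width_F_nonneg by simp
  qed (simp add: dims)
qed

text \<open>
  Scaling by a positive factor and inserting a constant coordinate preserve the signs of all
  differences, so monotonic sequences can be pulled back to \<open>F\<close>. The points pulled back are
  distinct because \<open>d'\<close> has a nonzero entry.
\<close>

lemma monotonic_seq_of_embed:
  assumes d: "d \<in> directions n" and zero: "d $ i0 = 0"
    and x: "\<And>p. p \<in> {1..len} \<Longrightarrow> x p \<in> F"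
    and sgns: "\<And>p q i. p \<in> {1..len} \<Longrightarrow> q \<in> {1..len} \<Longrightarrow> p < q \<Longrightarrow> i < n \<Longrightarrow>
      sgn (embed (x q) $ i - embed (x p) $ i) = real_of_int (d $ i)"
  obtains d' where "d' \<in> directions (n - 1)" "d = insert_zero i0 d'"
    "has_strictly_monotonic_seq (n - 1) F len d'"
proof -
  obtain d' where d': "d' \<in> directions (n - 1)" and eq: "d = insert_zero i0 d'"
    using directions_with_zero[OF d i0 zero] .
  have d'_dim: "dim_vec d' = n - 1" using d' by (auto simp: directions_def)
  have d'_val: "\<forall>i<n - 1. d' $ i \<in> {-1, 0, 1}" using d' by (auto simp: directions_def)
  have sgn': "sgn (x q $ j - x p $ j) = real_of_int (d' $ j)"
    if pq: "p \<in> {1..len}" "q \<in> {1..len}" "p < q" and j: "j < n - 1" for p q j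
  proof -
    have "embed (x q) $ skip i0 j - embed (x p) $ skip i0 j = (x q $ j - x p $ j) / (width F + 1)"
      using x pq j by (simp add: embed_skip diff_divide_distrib)
    then have "sgn (x q $ j - x p $ j) = sgn (embed (x q) $ skip i0 j - embed (x p) $ skip i0 j)"
      using width_F_nonneg by (simp add: sgn_divide)
    also have "\<dots> = real_of_int (d $ skip i0 j)"
      using sgns[OF pq skip_less[OF j]] .
    finally show ?thesis using insert_zero_skip[of j d' i0] j d'_dim eq by simp
  qed
  have mono: "strictly_monotonic_seq (n - 1) len x d'"
    unfolding strictly_monotonic_seq_iff_sgn[OF d'_val] using sgn' by blast
  obtain j where j: "j < n - 1" "d' $ j \<noteq> 0"
  proof -
    have "d' \<noteq> 0\<^sub>v (n - 1)" using d' by (auto simp: directions_def)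
    then show ?thesis using that d'_dim by (metis eq_vecI index_zero_vec(1,2))
  qed
  have neq: "x p \<noteq> x q" if "p \<in> {1..len}" "q \<in> {1..len}" "p < q" for p q
    using sgn'[OF that j(1)] j(2) by auto
  have "inj_on x {1..len}"
    using neq by (intro inj_onI) (metis linorder_neqE_nat)
  then have "has_strictly_monotonic_seq (n - 1) F len d'"
    using mono x unfolding has_strictly_monotonic_seq_def by blast
  with d' eq show ?thesis by (rule that)
qed

end

section \<open>Combining the two scales\<close>

text \<open>
  Positivity guarantees that \<open>F\<close>, whose cardinality is a \<open>\<lambda>\<close>-number, is finite and nonempty: the
  cardinality of an infinite set is 0.
\<close>

lemma lam_num_pos:
  assumes "\<And>d. d \<in> directions n \<Longrightarrow> l d > 0"
  shows "lam_num n l I > 0"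
proof (induction "card I" arbitrary: I)
  case 0
  then show ?case by (subst lam_num.simps) auto
next
  case (Suc k)
  then have I: "finite I" "I \<noteq> {}" using card_gt_0_iff[of I] by auto
  have "m_num n l I > 0"
    using assms by (auto simp: m_num_def intro!: prod_pos)
  moreover have "Max ((\<lambda>i. lam_num n l (I - {i})) ` I) \<in> (\<lambda>i. lam_num n l (I - {i})) ` I"
    using I by (intro Max_in) auto
  then obtain i where "i \<in> I" "Max ((\<lambda>i. lam_num n l (I - {i})) ` I) = lam_num n l (I - {i})"
    by blast
  ultimately show ?case
    using Suc I by (simp add: lam_num_nonempty)
qed

lemma sgn_add_small:
  fixes u v :: real
  assumes "\<bar>s\<bar> = 1" "\<bar>u\<bar> < 1" "real_of_int s * v \<ge> 1"
  shows "sgn (u + v) = real_of_int s"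
proof -
  have "s = 1 \<or> s = -1" using assms by auto
  then show ?thesis using assms by (auto simp: sgn_if)
qed

locale two_scale_set = scaled_set +
  fixes l :: "int vec \<Rightarrow> nat" and c :: "nat \<Rightarrow> int vec"
  assumes c: "bij_betw c {1..2 ^ (n - 1)} (full_directions n)"
begin

abbreviation "pt \<equiv> grid_point n l c (2 ^ (n - 1))"
definition "D = digits l c (2 ^ (n - 1))"

lemma c_full: "j \<in> {1..2 ^ (n - 1)} \<Longrightarrow> c j \<in> full_directions n"
  using c by (auto simp: bij_betw_def)

lemma E_set_eq: "E_set n l c = pt ` D"
  unfolding E_set_def D_def using c_full by (intro A_set_eq_grid_points) (auto simp: full_directions_def)

lemma G_set_eq: "G_set n l i0 F c = (\<lambda>(x, a). embed x + pt a) ` (F \<times> D)"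
  by (auto simp: G_set_def E_set_eq scaled_copy_eq translate_def)

lemma G_setE:
  assumes "g \<in> G_set n l i0 F c"
  obtains x a where "x \<in> F" "a \<in> D" "g = embed x + pt a"
proof -
  from assms obtain u where "u \<in> F \<times> D" "g = (\<lambda>(x, a). embed x + pt a) u"
    unfolding G_set_eq by (rule imageE)
  then show ?thesis
    by (intro that[of "fst u" "snd u"]) (simp_all add: mem_Times_iff case_prod_beta)
qed

lemma index_point: "x \<in> F \<Longrightarrow> i < n \<Longrightarrow> (embed x + pt a) $ i = embed x $ i + pt a $ i"
  by simp

text \<open>
  The index \<open>t\<close> depends on the coarse parts alone: the fine parts \<open>x\<close> and \<open>y\<close> perturb each
  coordinate difference by less than 1 and cannot affect its sign.
\<close>

lemma sgn_diff_points:
  assumes ab: "a \<in> D" "b \<in> D" "a \<noteq> b"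
  obtains t where "t \<in> {1..2 ^ (n - 1)}" "a t \<noteq> b t"
    "\<And>x y i. x \<in> F \<Longrightarrow> y \<in> F \<Longrightarrow> i < n \<Longrightarrow> sgn ((embed y + pt b) $ i - (embed x + pt a) $ i)
       = real_of_int (sgn (int (b t) - int (a t)) * c t $ i)"
proof -
  obtain t where t: "t \<in> {1..2 ^ (n - 1)}" "a t \<noteq> b t" and
    sep: "\<And>i. i < n \<Longrightarrow> real_of_int (sgn (int (b t) - int (a t)) * c t $ i) * (pt b $ i - pt a $ i) \<ge> 1"
    using grid_point_separation[OF c_full ab[unfolded D_def]] by blast
  show ?thesis
  proof (rule that[OF t])
    fix x y i assume xy: "x \<in> F" "y \<in> F" and i: "i < n"
    have "\<bar>c t $ i\<bar> = 1" using c_full[OF t(1)] i by (auto simp: full_directions_def)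
    then have "\<bar>sgn (int (b t) - int (a t)) * c t $ i\<bar> = 1"
      using t(2) by (simp add: abs_mult sgn_if)
    then have "sgn ((embed y $ i - embed x $ i) + (pt b $ i - pt a $ i))
        = real_of_int (sgn (int (b t) - int (a t)) * c t $ i)"
      using embed_close[OF xy(2,1) i] sep[OF i] by (rule sgn_add_small)
    then show "sgn ((embed y + pt b) $ i - (embed x + pt a) $ i)
        = real_of_int (sgn (int (b t) - int (a t)) * c t $ i)"
      using index_point[OF xy(1) i] index_point[OF xy(2) i] by (simp add: algebra_simps)
  qed
qed

lemma digits_eq_if_coordinate_eq:
  assumes "a \<in> D" "b \<in> D" "x \<in> F" "y \<in> F" "i < n"
    and eq: "(embed x + pt a) $ i = (embed y + pt b) $ i"
  shows "a = b"
proof (rule ccontr)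
  assume "a \<noteq> b"
  then obtain t where t: "t \<in> {1..2 ^ (n - 1)}" "a t \<noteq> b t"
    and s: "sgn ((embed y + pt b) $ i - (embed x + pt a) $ i)
       = real_of_int (sgn (int (b t) - int (a t)) * c t $ i)"
    using sgn_diff_points[OF assms(1,2)] assms by metis
  have "c t $ i \<noteq> 0" using c_full[OF t(1)] assms(5) by (auto simp: full_directions_def)
  with s eq t(2) show False by (simp add: sgn_zero_iff sgn_eq_0_iff)
qed

lemma inj_points: "inj_on (\<lambda>(x, a). embed x + pt a) (F \<times> D)"
proof (rule inj_onI, clarify)
  fix x a y b
  assume xy: "x \<in> F" "y \<in> F" and ab: "a \<in> D" "b \<in> D" and eq: "embed x + pt a = embed y + pt b"
  have "a = b"
    using digits_eq_if_coordinate_eq[OF ab xy i0] eq by simp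
  moreover have "embed x = embed y"
  proof (rule eq_vecI)
    fix i assume "i < dim_vec (embed y)"
    then have i: "i < n" using dim_embed xy by simp
    have "(embed x + pt a) $ i = (embed y + pt a) $ i" using eq \<open>a = b\<close> by simp
    then show "embed x $ i = embed y $ i" using index_point[OF _ i] xy by simp
  qed (use dim_embed xy in simp)
  ultimately show "x = y \<and> a = b"
    using inj_embed xy by (auto dest: inj_onD)
qed

lemma card_G_set: "card (G_set n l i0 F c) = m_num n l {..<n} * card F"
proof -
  have "card (G_set n l i0 F c) = card F * card D"
    unfolding G_set_eq card_image[OF inj_points] by (rule card_cartesian_product)
  also have "card D = (\<Prod>j=1..2 ^ (n - 1). l (c j))"
    by (simp add: D_def card_PiE)
  also have "\<dots> = (\<Prod>d\<in>full_directions n. l d)"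
    by (rule prod.reindex_bij_betw[OF c])
  also have "\<dots> = m_num n l {..<n}"
    using full_support_directions[of n] n by (simp add: m_num_def)
  finally show ?thesis by simp
qed

text \<open>
  The digit at the index of \<open>d\<close> in the enumeration \<open>c\<close> is strictly increasing along a sequence in
  direction \<open>d\<close>, and it takes fewer than \<open>l d + 1\<close> values.
\<close>

lemma no_full_direction_seq:
  assumes d: "d \<in> full_directions n"
  shows "\<not> has_strictly_monotonic_seq n (G_set n l i0 F c) (l d + 1) d"
proof
  assume "has_strictly_monotonic_seq n (G_set n l i0 F c) (l d + 1) d"
  then obtain g where gG: "g ` {1..l d + 1} \<subseteq> G_set n l i0 F c"
    and mono: "strictly_monotonic_seq n (l d + 1) g d"
    unfolding has_strictly_monotonic_seq_def by blast
  have d_val: "\<forall>i<n. d $ i \<in> {-1, 0, 1}" using d by (auto simp: full_directions_def)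
  have "\<forall>p\<in>{1..l d + 1}. \<exists>x a. x \<in> F \<and> a \<in> D \<and> g p = embed x + pt a"
    using gG G_setE by (metis image_subset_iff)
  then obtain x a where xa: "\<And>p. p \<in> {1..l d + 1} \<Longrightarrow> x p \<in> F \<and> a p \<in> D \<and> g p = embed (x p) + pt (a p)"
    by metis
  have sgns: "sgn (g q $ i - g p $ i) = real_of_int (d $ i)"
    if "p \<in> {1..l d + 1}" "q \<in> {1..l d + 1}" "p < q" "i < n" for p q i
    using mono that unfolding strictly_monotonic_seq_iff_sgn[OF d_val] by blast
  obtain k where k: "k \<in> {1..2 ^ (n - 1)}" "c k = d"
    using d bij_betw_imp_surj_on[OF c] by (metis imageE)
  have less: "a p k < a q k" if pq: "p \<in> {1..l d + 1}" "q \<in> {1..l d + 1}" "p < q" for p q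
  proof -
    \<comment> \<open>Equal coarse parts would force agreement in coordinate \<open>i0\<close>, where the fine part vanishes.\<close>
    have "a p \<noteq> a q"
    proof
      assume "a p = a q"
      then have "g q $ i0 - g p $ i0 = 0"
        using xa[OF pq(1)] xa[OF pq(2)] index_point[OF _ i0] embed_at by simp
      then have "d $ i0 = 0" using sgns[OF pq i0] by simp
      then show False using d i0 by (auto simp: full_directions_def)
    qed
    moreover have "a p \<in> D" "a q \<in> D" using xa pq by auto
    ultimately obtain t where t: "t \<in> {1..2 ^ (n - 1)}" "a p t \<noteq> a q t" and
      s: "\<And>i. i < n \<Longrightarrow> sgn (g q $ i - g p $ i)
         = real_of_int (sgn (int (a q t) - int (a p t)) * c t $ i)"
      using sgn_diff_points[of "a p" "a q"] xa[OF pq(1)] xa[OF pq(2)] by metis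
    have d_eq: "d $ i = sgn (int (a q t) - int (a p t)) * c t $ i" if "i < n" for i
      using s[OF that] sgns[OF pq that] by linarith
    \<comment> \<open>The normalised entry at index 0 excludes the sign pattern \<open>- c t\<close>.\<close>
    have "d $ 0 = 1" "c t $ 0 = 1"
      using d c_full[OF t(1)] by (auto simp: full_directions_def)
    then have pos: "sgn (int (a q t) - int (a p t)) = 1" using d_eq[of 0] n by simp
    have "c t = d"
      using d_eq pos d c_full[OF t(1)] by (intro eq_vecI) (auto simp: full_directions_def)
    then have "t = k" using inj_onD[OF bij_betw_imp_inj_on[OF c]] t(1) k by simp
    then show ?thesis using pos by (simp add: sgn_if split: if_splits)
  qed
  have "inj_on (\<lambda>p. a p k) {1..l d + 1}"
    using less by (intro inj_onI) (metis linorder_neqE_nat less_irrefl)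
  moreover have "(\<lambda>p. a p k) ` {1..l d + 1} \<subseteq> {..<l d}"
  proof
    fix m assume "m \<in> (\<lambda>p. a p k) ` {1..l d + 1}"
    then obtain p where p: "p \<in> {1..l d + 1}" "m = a p k" by blast
    then show "m \<in> {..<l d}" using xa[OF p(1)] k by (auto simp: D_def)
  qed
  ultimately show False
    using card_inj_on_le[of "\<lambda>p. a p k" "{1..l d + 1}" "{..<l d}"] by simp
qed

text \<open>
  Points with different coarse parts differ in every coordinate, so a sequence that is constant
  in one coordinate stays inside a single translate of the scaled copy of \<open>F\<close>.
\<close>

lemma monotonic_seq_with_zero_direction:
  assumes d: "d \<in> directions n" and i: "i < n" "d $ i = 0"
    and seq: "has_strictly_monotonic_seq n (G_set n l i0 F c) len d" and len: "len \<ge> 2"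
  obtains d' where "d' \<in> directions (n - 1)" "d = insert_zero i0 d'"
    "has_strictly_monotonic_seq (n - 1) F len d'"
proof -
  obtain g where gG: "g ` {1..len} \<subseteq> G_set n l i0 F c" and mono: "strictly_monotonic_seq n len g d"
    using seq unfolding has_strictly_monotonic_seq_def by blast
  have d_val: "\<forall>i<n. d $ i \<in> {-1, 0, 1}" using d by (auto simp: directions_def)
  have "\<forall>p\<in>{1..len}. \<exists>x a. x \<in> F \<and> a \<in> D \<and> g p = embed x + pt a"
    using gG G_setE by (metis image_subset_iff)
  then obtain x a where xa: "\<And>p. p \<in> {1..len} \<Longrightarrow> x p \<in> F \<and> a p \<in> D \<and> g p = embed (x p) + pt (a p)"
    by metis
  have sgns: "sgn (g q $ i - g p $ i) = real_of_int (d $ i)"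
    if "p \<in> {1..len}" "q \<in> {1..len}" "p < q" "i < n" for p q i
    using mono that unfolding strictly_monotonic_seq_iff_sgn[OF d_val] by blast
  have same: "a p = a q" if pq: "p \<in> {1..len}" "q \<in> {1..len}" "p < q" for p q
  proof (rule digits_eq_if_coordinate_eq[OF _ _ _ _ i(1)])
    show "(embed (x p) + pt (a p)) $ i = (embed (x q) + pt (a q)) $ i"
      using sgns[OF pq i(1)] i(2) xa[OF pq(1)] xa[OF pq(2)] by (simp add: sgn_zero_iff)
  qed (use xa pq in auto)
  have embed_sgns: "sgn (embed (x q) $ i - embed (x p) $ i) = real_of_int (d $ i)"
    if pq: "p \<in> {1..len}" "q \<in> {1..len}" "p < q" and i: "i < n" for p q i
    using sgns[OF pq i] xa[OF pq(1)] xa[OF pq(2)] same[OF pq] index_point[OF _ i] by simp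
  have "d $ i0 = 0"
    using embed_sgns[of 1 2 i0] len i0 xa embed_at by simp
  then show ?thesis
  proof (rule monotonic_seq_of_embed[OF d])
    show "x p \<in> F" if "p \<in> {1..len}" for p using xa[OF that] by blast
  qed (fact embed_sgns that)+
qed

end

theorem lemma9:
  fixes n i0 :: nat and l :: "int vec \<Rightarrow> nat"
    and F :: "real vec set" and c :: "nat \<Rightarrow> int vec"
  assumes "n \<ge> 2"
    and "\<And>d. d \<in> directions n \<Longrightarrow> l d \<ge> 2"
    and "i0 < n"
    and "lam_num n l {..<n} = m_num n l {..<n} * lam_num n l ({..<n} - {i0})"
    and "F \<subseteq> carrier_vec (n - 1)"
    and "card F = lam_num n l ({..<n} - {i0})"
    and "\<And>d. d \<in> directions (n - 1) \<Longrightarrow>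
           \<not> has_strictly_monotonic_seq (n - 1) F (restricted_lengths l i0 d + 1) d"
    and "bij_betw c {1..2 ^ (n - 1)} (full_directions n)"
  shows "card (G_set n l i0 F c) = lam_num n l {..<n} \<and>
    (\<forall>d\<in>directions n. \<not> has_strictly_monotonic_seq n (G_set n l i0 F c) (l d + 1) d)"
proof -
  have "card F > 0"
    using assms(2,6) by (force intro: lam_num_pos)
  then have "finite F" "F \<noteq> {}" by (auto simp: card_gt_0_iff)
  then interpret two_scale_set n i0 F l c
    using assms by unfold_locales auto
  show ?thesis
  proof (intro conjI ballI)
    show "card (G_set n l i0 F c) = lam_num n l {..<n}"
      using card_G_set assms(4,6) by simp
    fix d assume d: "d \<in> directions n"
    show "\<not> has_strictly_monotonic_seq n (G_set n l i0 F c) (l d + 1) d"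
    proof (cases "supp d = {..<n}")
      case True
      then have "d \<in> full_directions n"
        using d full_support_directions[of n] assms(1) by auto
      then show ?thesis by (rule no_full_direction_seq)
    next
      case False
      then obtain i where i: "i < n" "d $ i = 0"
        using d by (auto simp: directions_def supp_full_iff)
      show ?thesis
      proof
        assume "has_strictly_monotonic_seq n (G_set n l i0 F c) (l d + 1) d"
        moreover have "l d + 1 \<ge> 2" using assms(2)[OF d] by simp
        ultimately obtain d' where "d' \<in> directions (n - 1)" "d = insert_zero i0 d'"
            "has_strictly_monotonic_seq (n - 1) F (l d + 1) d'"
          using monotonic_seq_with_zero_direction[OF d i] by blast
        then show False
          using assms(7)[of d'] by (simp add: restricted_lengths_def)
      qed
    qed
  qed
qed

end
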